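(* Let $l\ge3$ be an integer and let $$H=\left(\begin{array}{c} I_{l}\otimes\begin{pmatrix}1&0&1&1&1\\0&1&1&w&w^2\end{pmatrix}\\ \hline \mathbf 1_l\otimes\begin{pmatrix}0&0&1&0&w^2\\0&0&0&1&w^2\end{pmatrix}\end{array}\right)$$ over $\mathbb F_4$. Then the linear code with parity-check matrix $H$ is an optimal quaternary $[n,k,d]$ $(r,\delta)$-LRC code with $n=5l$, $k=3l-2$, $d=5$, $r=3$, $\delta=3$.
   Context: $\mathbb F_4=\{0,1,w,w^2\}$ with $w^2=w+1$, $w^3=1$; $I_m$ is the $m\times m$ identity matrix, $\mathbf 1_l$ the all-ones row vector of length $l$, and $\otimes$ the Kronecker product. For a linear code $\mathcal C\subseteq\mathbb{F}_q^n$ and $R\subseteq[n]=\{1,\dots,n\}$, $\mathcal C|_R$ is the code obtained by puncturing (deleting) the coordinates outside $R$. An $[n,k,d]$ linear code $\mathcal C$ is an $(r,\delta)$-LRC code if for every $i\in[n]$ there is $R_i\subseteq[n]$ with $i\in R_i$, $|R_i|\le r+\delta-1$, such that $\mathcal C|_{R_i}$ has minimum distance at least $\delta$ (every nonzero word has weight at least $\delta$). Every such code satisfies $d\le n-k+1-(\lceil k/r\rceil-1)(\delta-1)$; it is $d$-optimal if equality holds. An $(r,\delta)$-LRC code is $r$-optimal if it is not an $(r',\delta)$-LRC code for any $1\le r'<r$. "Optimal $(r,\delta)$-LRC code" means an $(r,\delta)$-LRC code that is both $d$-optimal and $r$-optimal, with $d\ge\delta>2$ and $k>r\ge1$. *)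

theory Defs
  imports "Jordan_Normal_Form.Matrix_Kernel"
begin

section \<open>Linear codes\<close>

text \<open>
  Words of length \<open>n\<close> over a field are elements of \<^term>\<open>carrier_vec n\<close>. Coordinates are numbered
  \<open>0, \<dots>, n - 1\<close> rather than \<open>1, \<dots>, n\<close>.
\<close>

definition linear_code :: "nat \<Rightarrow> 'a::field vec set \<Rightarrow> bool" where
  "linear_code n C \<longleftrightarrow> subspace class_ring C (module_vec TYPE('a) n)"

definition code_dim :: "nat \<Rightarrow> 'a::field vec set \<Rightarrow> nat" where
  "code_dim n C = vectorspace.dim class_ring ((module_vec TYPE('a) n)\<lparr>carrier := C\<rparr>)"

definition weight :: "'a::zero vec \<Rightarrow> nat" where
  "weight v = card {i. i < dim_vec v \<and> v $ i \<noteq> 0}"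

definition min_dist_at_least :: "'a::zero vec set \<Rightarrow> nat \<Rightarrow> bool" where
  "min_dist_at_least C d \<longleftrightarrow> (\<forall>v\<in>C. v \<noteq> 0\<^sub>v (dim_vec v) \<longrightarrow> d \<le> weight v)"

definition has_min_dist :: "'a::zero vec set \<Rightarrow> nat \<Rightarrow> bool" where
  "has_min_dist C d \<longleftrightarrow>
     min_dist_at_least C d \<and> (\<exists>v\<in>C. v \<noteq> 0\<^sub>v (dim_vec v) \<and> weight v = d)"

definition nkd_code :: "nat \<Rightarrow> nat \<Rightarrow> nat \<Rightarrow> 'a::field vec set \<Rightarrow> bool" where
  "nkd_code n k d C \<longleftrightarrow> linear_code n C \<and> code_dim n C = k \<and> has_min_dist C d"

text \<open>\<open>puncture R C\<close> is \<open>C|\<^sub>R\<close>: \<open>R\<close> is the set of coordinates that are kept.\<close>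

definition puncture :: "nat set \<Rightarrow> 'a vec set \<Rightarrow> 'a vec set" where
  "puncture R C = (\<lambda>v. vec_of_list (nths (list_of_vec v) R)) ` C"


section \<open>Locally repairable codes\<close>

definition lrc :: "nat \<Rightarrow> nat \<Rightarrow> nat \<Rightarrow> 'a::field vec set \<Rightarrow> bool" where
  "lrc n r \<delta> C \<longleftrightarrow> linear_code n C \<and>
     (\<forall>i<n. \<exists>R. R \<subseteq> {..<n} \<and> i \<in> R \<and> card R \<le> r + \<delta> - 1 \<and> min_dist_at_least (puncture R C) \<delta>)"

text \<open>Equality in the Singleton-like bound, over the integers to avoid truncated subtraction.\<close>

definition d_optimal :: "nat \<Rightarrow> nat \<Rightarrow> nat \<Rightarrow> nat \<Rightarrow> nat \<Rightarrow> bool" where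
  "d_optimal n k d r \<delta> \<longleftrightarrow>
     int d = int n - int k + 1 - (\<lceil>real k / real r\<rceil> - 1) * (int \<delta> - 1)"

definition r_optimal :: "nat \<Rightarrow> nat \<Rightarrow> nat \<Rightarrow> 'a::field vec set \<Rightarrow> bool" where
  "r_optimal n r \<delta> C \<longleftrightarrow> (\<forall>r'. 1 \<le> r' \<and> r' < r \<longrightarrow> \<not> lrc n r' \<delta> C)"

definition optimal_lrc ::
    "nat \<Rightarrow> nat \<Rightarrow> nat \<Rightarrow> nat \<Rightarrow> nat \<Rightarrow> 'a::field vec set \<Rightarrow> bool" where
  "optimal_lrc n k d r \<delta> C \<longleftrightarrow>
     nkd_code n k d C \<and> lrc n r \<delta> C \<and> d_optimal n k d r \<delta> \<and> r_optimal n r \<delta> C \<and>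
     d \<ge> \<delta> \<and> \<delta> > 2 \<and> k > r \<and> r \<ge> 1"


section \<open>The parity-check matrix\<close>

definition kronecker :: "'a::times mat \<Rightarrow> 'a mat \<Rightarrow> 'a mat" (infixl \<open>\<otimes>\<^sub>K\<close> 70) where
  "A \<otimes>\<^sub>K B = mat (dim_row A * dim_row B) (dim_col A * dim_col B)
     (\<lambda>(i, j). A $$ (i div dim_row B, j div dim_col B) * B $$ (i mod dim_row B, j mod dim_col B))"

definition all_ones_row :: "nat \<Rightarrow> 'a::one mat" where
  "all_ones_row l = mat 1 l (\<lambda>_. 1)"

definition parity_matrix :: "'a::field \<Rightarrow> nat \<Rightarrow> 'a mat" where
  "parity_matrix w l =
     (1\<^sub>m l \<otimes>\<^sub>K mat_of_rows_list 5 [[1, 0, 1, 1, 1],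
                                  [0, 1, 1, w, w\<^sup>2]])
     @\<^sub>r
     (all_ones_row l \<otimes>\<^sub>K mat_of_rows_list 5 [[0, 0, 1, 0, w\<^sup>2],
                                           [0, 0, 0, 1, w\<^sup>2]])"

end

(* Every block of a codeword lies in a [5,3,3] MDS code, so two nonzero blocks already give weight 6,
   while a codeword supported on one block is a scalar multiple of (1, 1, w^2, w^2, 1) and has weight 5.
   The dimension follows from rank-nullity because v |-> H v is onto: x and y of one block fix the two
   global checks, and then the first two coordinates of each block fix its local checks.

   No repair group R containing coordinate 0 has at most 4 elements: if R meets some block in one or
   two points, the weight-5 word of that block has restricted weight 1 or 2.  Otherwise R lies inside
   block 0, and a local word of weight 3 through 0 and through a point of the block outside R, repeated
   in block 1, has restricted weight at most 2. *)

theory Submission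
  imports Defs
begin

section \<open>Weights of words and of their punctured versions\<close>

lemma sum_lessThan_5: "(\<Sum>k<5. f k) = f 0 + f 1 + f 2 + f 3 + f (4 :: nat)"
  for f :: "nat \<Rightarrow> 'a::comm_monoid_add"
  by (simp add: eval_nat_numeral)

lemma weight_eq_0_iff: "weight v = 0 \<longleftrightarrow> v = 0\<^sub>v (dim_vec v)"
  unfolding weight_def vec_eq_iff by auto

text \<open>Puncturing renumbers positions; this moves all later counting back to the original
  coordinates in \<open>R\<close>.\<close>

lemma weight_puncture:
  "weight (vec_of_list (nths (list_of_vec v) R)) = card {i \<in> R. i < dim_vec v \<and> v $ i \<noteq> 0}"
proof -
  \<comment> \<open>\<open>nths\<close> filters the list paired with its indices, so a further
    filter by \<open>P\<close> merely adds a second condition on the pairs.\<close>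
  have filter_nths: "length (filter P (nths xs R)) = card {i \<in> R. i < length xs \<and> P (xs ! i)}"
    for P and xs :: "'a list"
  proof -
    have "length (filter P (nths xs R)) =
        length (filter (\<lambda>p. P (fst p) \<and> snd p \<in> R) (zip xs [0..<length xs]))"
      by (simp add: nths_def filter_map comp_def conj_commute)
    also have "\<dots> = card {i \<in> R. i < length xs \<and> P (xs ! i)}"
      by (auto simp: length_filter_conv_card intro!: arg_cong[where f = card])
    finally show ?thesis .
  qed
  have "weight (vec_of_list xs) = length (filter (\<lambda>x. x \<noteq> 0) xs)" for xs :: "'a list"
    by (auto simp: weight_def length_filter_conv_card vec_of_list_index
        intro!: arg_cong[where f = card])
  then show ?thesis
    by (auto simp: filter_nths list_of_vec_index intro!: arg_cong[where f = card])
qed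

text \<open>A word is nonzero exactly when its weight is nonzero, so punctured words can be
  eliminated in favour of counts over \<open>R\<close>.\<close>

lemma min_dist_at_least_puncture_iff:
  "min_dist_at_least (puncture R C) d \<longleftrightarrow>
     (\<forall>v\<in>C. card {i \<in> R. i < dim_vec v \<and> v $ i \<noteq> 0} \<noteq> 0 \<longrightarrow>
        d \<le> card {i \<in> R. i < dim_vec v \<and> v $ i \<noteq> 0})"
proof -
  have "min_dist_at_least D d \<longleftrightarrow> (\<forall>v\<in>D. weight v \<noteq> 0 \<longrightarrow> d \<le> weight v)"
    for D :: "'a vec set"
    by (simp add: min_dist_at_least_def weight_eq_0_iff)
  then show ?thesis
    unfolding puncture_def by (simp only: ball_simps weight_puncture)
qed

section \<open>Codes as kernels, and the parity checks in coordinates\<close>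

lemma mat_kernel_of_surj:
  fixes A :: "'a::field mat"
  assumes A: "A \<in> carrier_mat nr nc"
    and surj: "\<And>b. b \<in> carrier_vec nr \<Longrightarrow> \<exists>v\<in>carrier_vec nc. A *\<^sub>v v = b"
  shows "linear_code nc (mat_kernel A)" "code_dim nc (mat_kernel A) = nc - nr"
proof -
  let ?V = "module_vec TYPE('a) nc" and ?W = "module_vec TYPE('a) nr"
  let ?T = "\<lambda>v. A *\<^sub>v v"
  have "?T \<in> LinearCombinations.module_hom class_ring ?V ?W"
    using A by (auto simp: LinearCombinations.module_hom_def module_vec_simps mult_add_distrib_mat_vec mult_mat_vec)
  then have T: "linear_map class_ring ?V ?W ?T"
    by (intro linear_map.intro mod_hom.intro mod_hom_axioms.intro vec_vs vec_module)
  then have hom: "mod_hom class_ring ?V ?W ?T"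
    by (rule linear_map.axioms)
  have ker: "mod_hom.ker ?V ?W ?T = mat_kernel A"
    using A by (auto simp: mod_hom.ker_def[OF hom] mat_kernel_def module_vec_simps)
  \<comment> \<open>Surjectivity turns the rank into the full number \<open>nr\<close> of checks,
    which rank-nullity then subtracts from the length.\<close>
  have im: "mod_hom.im ?V ?T = carrier ?W"
    using A surj by (auto simp: mod_hom.im_def[OF hom] module_vec_simps)
  show "linear_code nc (mat_kernel A)"
    using linear_map.kerT_is_subspace[OF T] by (simp add: linear_code_def ker)
  have "vectorspace.dim class_ring ?W + code_dim nc (mat_kernel A) =
      vectorspace.dim class_ring ?V"
    using linear_map.rank_nullity[OF T vec_space.fin_dim] by (simp add: code_dim_def ker im)
  then show "code_dim nc (mat_kernel A) = nc - nr"
    by (simp add: vec_space.dim_is_n)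
qed

text \<open>Cut \<open>v\<close> into consecutive blocks of length \<open>dim_col B\<close>: the
  inner sum applies \<open>B\<close> to each block, and the outer sum combines the results with
  coefficients from \<open>A\<close>.\<close>

lemma kronecker_mult_vec_index:
  fixes A B :: "'a::comm_semiring_1 mat"
  assumes "v \<in> carrier_vec (dim_col A * dim_col B)" "i < dim_row A * dim_row B"
  shows "((A \<otimes>\<^sub>K B) *\<^sub>v v) $ i =
    (\<Sum>j<dim_col A. A $$ (i div dim_row B, j) *
       (\<Sum>k<dim_col B. B $$ (i mod dim_row B, k) * v $ (j * dim_col B + k)))"
proof -
  let ?c = "dim_col B"
  let ?f = "\<lambda>i'. A $$ (i div dim_row B, i' div ?c) * B $$ (i mod dim_row B, i' mod ?c) * v $ i'"
  have "((A \<otimes>\<^sub>K B) *\<^sub>v v) $ i = (\<Sum>i'<dim_col A * ?c. ?f i')"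
    using assms by (simp add: kronecker_def scalar_prod_def lessThan_atLeast0)
  also have "\<dots> = (\<Sum>j<dim_col A. \<Sum>i'\<in>{j * ?c..<j * ?c + ?c}. ?f i')"
    by (rule sum.nat_group[symmetric])
  also have "\<dots> = (\<Sum>j<dim_col A. A $$ (i div dim_row B, j) *
      (\<Sum>k<?c. B $$ (i mod dim_row B, k) * v $ (j * ?c + k)))"
  proof (rule sum.cong[OF refl])
    fix j
    have "(\<Sum>i'\<in>{j * ?c..<j * ?c + ?c}. ?f i') = (\<Sum>k<?c. ?f (j * ?c + k))"
      using sum.shift_bounds_nat_ivl[of ?f 0 "j * ?c" ?c]
      by (simp add: lessThan_atLeast0 add.commute)
    also have "\<dots> = A $$ (i div dim_row B, j) *
        (\<Sum>k<?c. B $$ (i mod dim_row B, k) * v $ (j * ?c + k))"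
      unfolding sum_distrib_left by (intro sum.cong) (auto simp: mult.assoc)
    finally show "(\<Sum>i'\<in>{j * ?c..<j * ?c + ?c}. ?f i') = A $$ (i div dim_row B, j) *
        (\<Sum>k<?c. B $$ (i mod dim_row B, k) * v $ (j * ?c + k))" .
  qed
  finally show ?thesis .
qed

lemma parity_matrix_carrier: "parity_matrix w l \<in> carrier_mat (2 * l + 2) (5 * l)"
proof -
  have "1\<^sub>m l \<otimes>\<^sub>K mat_of_rows_list 5 [[1, 0, 1, 1, 1], [0, 1, 1, w, w\<^sup>2]]
      \<in> carrier_mat (2 * l) (5 * l)"
    "all_ones_row l \<otimes>\<^sub>K mat_of_rows_list 5 [[0, 0, 1, 0, w\<^sup>2], [0, 0, 0, 1, w\<^sup>2]]
      \<in> carrier_mat 2 (5 * l)"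
    by (auto simp: kronecker_def all_ones_row_def mat_of_rows_list_def)
  then show ?thesis
    unfolding parity_matrix_def by (rule carrier_append_rows)
qed

text \<open>The identity factor makes rows \<open>2 * j\<close> and \<open>2 * j + 1\<close> local
  to block \<open>j\<close>; the all-ones factor makes the last two rows add up contributions of all
  blocks.\<close>

lemma parity_matrix_mult_vec:
  fixes w :: "'a::field"
  assumes v: "v \<in> carrier_vec (5 * l)"
  shows
    "j < l \<Longrightarrow> (parity_matrix w l *\<^sub>v v) $ (2 * j) =
       v $ (5 * j) + v $ (5 * j + 2) + v $ (5 * j + 3) + v $ (5 * j + 4)"
    "j < l \<Longrightarrow> (parity_matrix w l *\<^sub>v v) $ (2 * j + 1) =
       v $ (5 * j + 1) + v $ (5 * j + 2) + w * v $ (5 * j + 3) + w\<^sup>2 * v $ (5 * j + 4)"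
    "(parity_matrix w l *\<^sub>v v) $ (2 * l) =
       (\<Sum>j<l. v $ (5 * j + 2) + w\<^sup>2 * v $ (5 * j + 4))"
    "(parity_matrix w l *\<^sub>v v) $ (2 * l + 1) =
       (\<Sum>j<l. v $ (5 * j + 3) + w\<^sup>2 * v $ (5 * j + 4))"
proof -
  define P where "P = mat_of_rows_list 5 [[1, 0, 1, 1, 1], [0, 1, 1, w, w\<^sup>2]]"
  define Q where "Q = mat_of_rows_list 5 [[0, 0, 1, 0, w\<^sup>2], [0, 0, 0, 1, w\<^sup>2]]"
  have dims: "dim_row P = 2" "dim_col P = 5" "dim_row Q = 2" "dim_col Q = 5"
    by (auto simp: P_def Q_def mat_of_rows_list_def)
  have carrier: "1\<^sub>m l \<otimes>\<^sub>K P \<in> carrier_mat (2 * l) (5 * l)"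
    "all_ones_row l \<otimes>\<^sub>K Q \<in> carrier_mat 2 (5 * l)"
    by (auto simp: kronecker_def all_ones_row_def dims)
  have split: "parity_matrix w l *\<^sub>v v = ((1\<^sub>m l \<otimes>\<^sub>K P) *\<^sub>v v) @\<^sub>v ((all_ones_row l \<otimes>\<^sub>K Q) *\<^sub>v v)"
    unfolding parity_matrix_def P_def[symmetric] Q_def[symmetric]
    by (rule mat_mult_append[OF carrier v])
  have upper: "(parity_matrix w l *\<^sub>v v) $ i =
      (\<Sum>k<5. P $$ (i mod 2, k) * v $ (i div 2 * 5 + k))" if i: "i < 2 * l" for i
  proof -
    have "(parity_matrix w l *\<^sub>v v) $ i = ((1\<^sub>m l \<otimes>\<^sub>K P) *\<^sub>v v) $ i"
      using i carrier by (simp add: split)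
    also have "\<dots> = (\<Sum>j<l. (1\<^sub>m l :: 'a mat) $$ (i div 2, j) * (\<Sum>k<5. P $$ (i mod 2, k) * v $ (j * 5 + k)))"
      using i v by (subst kronecker_mult_vec_index) (auto simp: dims mult.commute)
    also have "\<dots> = (\<Sum>j<l. if j = i div 2 then \<Sum>k<5. P $$ (i mod 2, k) * v $ (j * 5 + k) else 0)"
      using i by (intro sum.cong) auto
    also have "\<dots> = (\<Sum>k<5. P $$ (i mod 2, k) * v $ (i div 2 * 5 + k))"
      using i by (simp add: sum.delta)
    finally show ?thesis .
  qed
  have lower: "(parity_matrix w l *\<^sub>v v) $ (2 * l + i) =
      (\<Sum>j<l. \<Sum>k<5. Q $$ (i, k) * v $ (j * 5 + k))" if i: "i < 2" for i
  proof -
    have "(parity_matrix w l *\<^sub>v v) $ (2 * l + i) = ((all_ones_row l \<otimes>\<^sub>K Q) *\<^sub>v v) $ i"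
      using i carrier by (simp add: split)
    also have "\<dots> = (\<Sum>j<l. \<Sum>k<5. Q $$ (i, k) * v $ (j * 5 + k))"
      using i v
      by (subst kronecker_mult_vec_index) (auto simp: dims mult.commute all_ones_row_def)
    finally show ?thesis .
  qed
  note entries = P_def Q_def mat_of_rows_list_def sum_lessThan_5
  show "j < l \<Longrightarrow> (parity_matrix w l *\<^sub>v v) $ (2 * j) =
       v $ (5 * j) + v $ (5 * j + 2) + v $ (5 * j + 3) + v $ (5 * j + 4)"
    by (subst upper) (simp_all add: entries mult.commute[of 5])
  show "j < l \<Longrightarrow> (parity_matrix w l *\<^sub>v v) $ (2 * j + 1) =
       v $ (5 * j + 1) + v $ (5 * j + 2) + w * v $ (5 * j + 3) + w\<^sup>2 * v $ (5 * j + 4)"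
    by (subst upper) (simp_all add: entries mult.commute[of 5])
  show "(parity_matrix w l *\<^sub>v v) $ (2 * l) =
       (\<Sum>j<l. v $ (5 * j + 2) + w\<^sup>2 * v $ (5 * j + 4))"
    using lower[of 0] by (simp add: entries mult.commute[of 5])
  show "(parity_matrix w l *\<^sub>v v) $ (2 * l + 1) =
       (\<Sum>j<l. v $ (5 * j + 3) + w\<^sup>2 * v $ (5 * j + 4))"
    using lower[of 1] by (simp add: entries mult.commute[of 5])
qed

lemma mem_mat_kernel_parity_iff:
  "v \<in> mat_kernel (parity_matrix w l) \<longleftrightarrow> v \<in> carrier_vec (5 * l) \<and>
    (\<forall>j<l. v $ (5 * j) + v $ (5 * j + 2) + v $ (5 * j + 3) + v $ (5 * j + 4) = 0 \<and>
       v $ (5 * j + 1) + v $ (5 * j + 2) + w * v $ (5 * j + 3) + w\<^sup>2 * v $ (5 * j + 4) = 0) \<and>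
    (\<Sum>j<l. v $ (5 * j + 2) + w\<^sup>2 * v $ (5 * j + 4)) = 0 \<and>
    (\<Sum>j<l. v $ (5 * j + 3) + w\<^sup>2 * v $ (5 * j + 4)) = 0"
proof (cases "v \<in> carrier_vec (5 * l)")
  case True
  have rows: "(\<forall>i<2 * l + 2. P i) \<longleftrightarrow>
      (\<forall>j<l. P (2 * j) \<and> P (2 * j + 1)) \<and> P (2 * l) \<and> P (2 * l + 1)"
    for P :: "nat \<Rightarrow> bool"
  proof (intro iffI allI impI)
    fix i assume P: "(\<forall>j<l. P (2 * j) \<and> P (2 * j + 1)) \<and> P (2 * l) \<and> P (2 * l + 1)"
      and "i < 2 * l + 2"
    then consider "i div 2 < l" | "i div 2 = l"
      by linarith
    then show "P i"
      using P by cases (metis mod2_eq_if mult_div_mod_eq add.right_neutral)+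
  qed auto
  have "v \<in> mat_kernel (parity_matrix w l) \<longleftrightarrow>
      (\<forall>i<2 * l + 2. (parity_matrix w l *\<^sub>v v) $ i = 0)"
    using True by (auto simp: mat_kernel[OF parity_matrix_carrier] vec_eq_iff
        carrier_matD[OF parity_matrix_carrier] simp del: index_mult_mat_vec)
  then show ?thesis
    unfolding rows using True by (simp add: parity_matrix_mult_vec del: index_mult_mat_vec One_nat_def)
qed (simp add: mat_kernel[OF parity_matrix_carrier])

section \<open>Words prescribed block by block, and surjectivity of the syndrome map\<close>

definition block_word :: "nat \<Rightarrow> (nat \<Rightarrow> nat \<Rightarrow> 'a) \<Rightarrow> 'a vec" where
  "block_word l g = vec (5 * l) (\<lambda>i. g (i div 5) (i mod 5))"

lemma block_word_carrier [simp]: "block_word l g \<in> carrier_vec (5 * l)"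
  by (simp add: block_word_def)

lemma dim_block_word [simp]: "dim_vec (block_word l g) = 5 * l"
  by (simp add: block_word_def)

lemma block_word_index:
  assumes "j < l"
  shows "k < 5 \<Longrightarrow> block_word l g $ (5 * j + k) = g j k" "block_word l g $ (5 * j) = g j 0"
  using assms by (auto simp: block_word_def)

lemma block_word_mem_iff:
  "block_word l g \<in> mat_kernel (parity_matrix w l) \<longleftrightarrow>
    (\<forall>j<l. g j 0 + g j 2 + g j 3 + g j 4 = 0 \<and> g j 1 + g j 2 + w * g j 3 + w\<^sup>2 * g j 4 = 0) \<and>
    (\<Sum>j<l. g j 2 + w\<^sup>2 * g j 4) = 0 \<and> (\<Sum>j<l. g j 3 + w\<^sup>2 * g j 4) = 0"
  by (simp add: mem_mat_kernel_parity_iff block_word_index cong: sum.cong_simp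
      del: One_nat_def add_2_eq_Suc')

lemma parity_matrix_surj:
  fixes w :: "'a::field"
  assumes l: "l \<ge> 1" and b: "b \<in> carrier_vec (2 * l + 2)"
  shows "\<exists>v\<in>carrier_vec (5 * l). parity_matrix w l *\<^sub>v v = b"
proof -
  \<comment> \<open>With position 4 left at 0, the global checks reduce to the sums of the
    \<open>x j\<close> and of the \<open>y j\<close>, and block 0 alone supplies both
    values.\<close>
  define x y where "x j = (if j = 0 then b $ (2 * l) else 0)"
    and "y j = (if j = 0 then b $ (2 * l + 1) else 0)" for j :: nat
  \<comment> \<open>Columns 0 and 1 form an identity matrix in the local checks and vanish in the
    global ones, so the first two entries correct the local syndrome without disturbing the global
    one.\<close>
  define v where "v = block_word l (\<lambda>j k.
    [b $ (2 * j) - x j - y j, b $ (2 * j + 1) - x j - w * y j, x j, y j, 0] ! k)"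
  have v: "v \<in> carrier_vec (5 * l)"
    by (simp add: v_def)
  have "(parity_matrix w l *\<^sub>v v) $ i = b $ i" if i: "i < 2 * l + 2" for i
  proof -
    consider j where "j < l" "i = 2 * j" | j where "j < l" "i = 2 * j + 1"
      | "i = 2 * l" | "i = 2 * l + 1"
    proof -
      assume a: "\<And>j. j < l \<Longrightarrow> i = 2 * j \<Longrightarrow> thesis" "\<And>j. j < l \<Longrightarrow> i = 2 * j + 1 \<Longrightarrow> thesis"
        "i = 2 * l \<Longrightarrow> thesis" "i = 2 * l + 1 \<Longrightarrow> thesis"
      show thesis
      proof -
        have "i = 2 * (i div 2) \<or> i = 2 * (i div 2) + 1" "i div 2 < l \<or> i div 2 = l"
          using i by linarith+
        then show thesis
          using a by metis
      qed
    qed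
    then show ?thesis
    proof cases
      case (1 j)
      then show ?thesis
        unfolding 1(2) parity_matrix_mult_vec(1)[OF v 1(1)] by (simp add: v_def block_word_index del: One_nat_def add_2_eq_Suc')
    next
      case (2 j)
      then show ?thesis
        unfolding 2(2) parity_matrix_mult_vec(2)[OF v 2(1)] by (simp add: v_def block_word_index del: One_nat_def add_2_eq_Suc')
    next
      case 3
      show ?thesis
        unfolding 3 parity_matrix_mult_vec(3)[OF v] using l
        by (simp add: v_def x_def block_word_index sum.delta del: One_nat_def add_2_eq_Suc')
    next
      case 4
      show ?thesis
        unfolding 4 parity_matrix_mult_vec(4)[OF v] using l
        by (simp add: v_def y_def block_word_index sum.delta del: One_nat_def add_2_eq_Suc')
    qed
  qed
  then have "parity_matrix w l *\<^sub>v v = b"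
    using b by (intro eq_vecI) (auto simp: carrier_matD[OF parity_matrix_carrier]
        simp del: index_mult_mat_vec)
  then show ?thesis
    using v by blast
qed

section \<open>Weights of single blocks\<close>

definition block_weight :: "'a::zero vec \<Rightarrow> nat \<Rightarrow> nat" where
  "block_weight v j = card {k. k < 5 \<and> v $ (5 * j + k) \<noteq> 0}"

lemma weight_in_block:
  assumes "v \<in> carrier_vec (5 * l)" "j < l"
  shows "card {i \<in> {5 * j..<5 * j + 5}. i < dim_vec v \<and> v $ i \<noteq> 0} = block_weight v j"
proof -
  have "{i \<in> {5 * j..<5 * j + 5}. i < dim_vec v \<and> v $ i \<noteq> 0} =
      (\<lambda>k. 5 * j + k) ` {k. k < 5 \<and> v $ (5 * j + k) \<noteq> 0}"
  proof (intro equalityI subsetI)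
    fix i assume i: "i \<in> {i \<in> {5 * j..<5 * j + 5}. i < dim_vec v \<and> v $ i \<noteq> 0}"
    then show "i \<in> (\<lambda>k. 5 * j + k) ` {k. k < 5 \<and> v $ (5 * j + k) \<noteq> 0}"
      by (intro image_eqI[of _ _ "i - 5 * j"]) auto
  qed (use assms in auto)
  then show ?thesis
    by (simp add: block_weight_def card_image)
qed

text \<open>Blocks occupy disjoint coordinates, so their weights add. A set \<open>J\<close> of
  blocks covers the two uses: one nonzero block, or two.\<close>

lemma block_weight_sum_le:
  assumes v: "v \<in> carrier_vec (5 * l)" and J: "J \<subseteq> {..<l}"
  shows "(\<Sum>j\<in>J. block_weight v j) \<le> weight v"
proof -
  have fin: "finite J"
    using J finite_subset by blast
  have "(\<Sum>j\<in>J. block_weight v j) =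
      (\<Sum>j\<in>J. card {i \<in> {5 * j..<5 * j + 5}. i < dim_vec v \<and> v $ i \<noteq> 0})"
    using J by (intro sum.cong refl weight_in_block[OF v, symmetric]) auto
  also have "\<dots> = card (\<Union>j\<in>J. {i \<in> {5 * j..<5 * j + 5}. i < dim_vec v \<and> v $ i \<noteq> 0})"
    using fin by (intro card_UN_disjoint[symmetric]) auto
  also have "\<dots> \<le> weight v"
    unfolding weight_def by (rule card_mono) auto
  finally show ?thesis .
qed

lemma block_weight_conv:
  "block_weight v j = (if v $ (5 * j) \<noteq> 0 then 1 else 0) + (if v $ (5 * j + 1) \<noteq> 0 then 1 else 0) +
     (if v $ (5 * j + 2) \<noteq> 0 then 1 else 0) + (if v $ (5 * j + 3) \<noteq> 0 then 1 else 0) +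
     (if v $ (5 * j + 4) \<noteq> 0 then 1 else 0)"
proof -
  have "block_weight v j = (\<Sum>k<5. if v $ (5 * j + k) \<noteq> 0 then 1 else 0)"
    by (auto simp: block_weight_def sum.If_cases intro!: arg_cong[where f = card])
  then show ?thesis
    by (simp add: eval_nat_numeral)
qed

lemma block_nonzero:
  assumes v: "v \<in> carrier_vec (5 * l)" and "v \<noteq> 0\<^sub>v (5 * l)"
  shows "\<exists>j<l. block_weight v j \<noteq> 0"
proof -
  obtain i where i: "i < 5 * l" "v $ i \<noteq> 0"
    using assms by (metis carrier_vecD eq_vecI index_zero_vec)
  have "i mod 5 \<in> {k. k < 5 \<and> v $ (5 * (i div 5) + k) \<noteq> 0}"
    using i by simp
  then have "{k. k < 5 \<and> v $ (5 * (i div 5) + k) \<noteq> 0} \<noteq> {}"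
    by blast
  then have "block_weight v (i div 5) \<noteq> 0"
    by (simp add: block_weight_def card_eq_0_iff)
  moreover have "i div 5 < l"
    using i by linarith
  ultimately show ?thesis by blast
qed

section \<open>Arithmetic in the field of four elements\<close>

lemma card_4_field_char_2:
  assumes "card (UNIV :: 'a::field set) = 4"
  shows "(1 :: 'a) + 1 = 0"
proof -
  have fin: "finite (UNIV :: 'a set)"
    using assms card.infinite by fastforce
  \<comment> \<open>Translation by 1 permutes the field, so adding 1 to each of its four elements
    preserves their sum; hence 4 = (1 + 1)^2 is 0.\<close>
  have "(\<Sum>x::'a\<in>UNIV. x) = (\<Sum>x\<in>UNIV. x + 1)"
    by (rule sum.reindex_bij_witness[of _ "\<lambda>x. x + 1" "\<lambda>x. x - 1"]) auto
  also have "\<dots> = (\<Sum>x::'a\<in>UNIV. x) + of_nat 4"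
    using assms by (simp add: sum.distrib)
  finally have "((1 :: 'a) + 1) * (1 + 1) = 0"
    by simp
  then show ?thesis
    by (simp only: mult_eq_0_iff simp_thms)
qed

context
  fixes w :: "'a::field"
  assumes two: "(1 :: 'a) + 1 = 0" and w: "w\<^sup>2 = w + 1"
begin

lemma self_add: "x + x = (0 :: 'a)"
  using two by (metis mult_2 mult_zero_left one_add_one)

lemma self_add_left: "x + (x + y) = (y :: 'a)"
  by (simp add: self_add flip: add.assoc)

text \<open>Negation is the identity in characteristic 2, so a check with two terms reads as an
  equality.\<close>

lemma add_eq_0_iff_eq: "x + y = 0 \<longleftrightarrow> x = (y :: 'a)"
  by (metis self_add add_left_cancel)

lemma w_nonzero: "w \<noteq> 0" "w \<noteq> 1" "w + 1 \<noteq> 0"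
  using w two by auto

lemma w_cube: "w * w\<^sup>2 = 1"
proof -
  have "w * w\<^sup>2 = w * w + w * 1"
    unfolding w by (rule distrib_left)
  also have "\<dots> = w + (w + 1)"
    unfolding power2_eq_square[symmetric] w mult_1_right by (rule add.commute)
  also have "\<dots> = 1"
    by (rule self_add_left)
  finally show ?thesis .
qed

text \<open>The columns represent the points (1:0), (0:1), (1:1), (1:w), (1:w^2) of the projective
  line. These are distinct because 0, 1, w and w^2 are, so every 2 by 2 minor is nonzero.\<close>

lemma block_columns_independent:
  assumes "k < 5" "m < 5" "k \<noteq> m"
  shows "[1, 0, 1, 1, 1] ! k * [0, 1, 1, w, w\<^sup>2] ! m \<noteq> [0, 1, 1, w, w\<^sup>2] ! k * [1, 0, 1, 1, 1] ! m"
proof -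
  define s where "s = w\<^sup>2"
  have "s \<noteq> 0" "s \<noteq> 1" "s \<noteq> w"
    unfolding s_def using w_nonzero by (auto simp: w)
  moreover have "k = 0 \<or> k = 1 \<or> k = 2 \<or> k = 3 \<or> k = 4" "m = 0 \<or> m = 1 \<or> m = 2 \<or> m = 3 \<or> m = 4"
    using assms by linarith+
  ultimately show ?thesis
    using assms(3) w_nonzero(1,2) unfolding s_def[symmetric] by (elim disjE) auto
qed

text \<open>Any two columns of the \<open>2 \<times> 5\<close> block parity-check matrix are independent, so no nonzero local
  word has weight at most 2.\<close>

lemma block_weight_ge_3:
  assumes v: "v \<in> mat_kernel (parity_matrix w l)" and j: "j < l" and nz: "block_weight v j \<noteq> 0"
  shows "3 \<le> block_weight v j"
proof (rule ccontr)
  define f where "f k = v $ (5 * j + k)" for k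
  define P Q where "P = (!) [1, 0, 1, 1, 1 :: 'a]" and "Q = (!) [0, 1, 1, w, w\<^sup>2]"
  have "f 0 + f 2 + f 3 + f 4 = 0" "f 1 + f 2 + w * f 3 + w\<^sup>2 * f 4 = 0"
    using v j by (simp_all only: mem_mat_kernel_parity_iff f_def add_0_right)
  then have zero: "(\<Sum>k<5. P k * f k) = 0" "(\<Sum>k<5. Q k * f k) = 0"
    by (simp_all add: sum_lessThan_5 P_def Q_def)
  let ?S = "{k. k < 5 \<and> f k \<noteq> 0}"
  assume "\<not> 3 \<le> block_weight v j"
  then have "card ?S \<le> 2"
    by (simp add: block_weight_def f_def)
  \<comment> \<open>Padding the support to exactly two positions treats weights 1 and 2
    together.\<close>
  then obtain T where T: "?S \<subseteq> T" "T \<subseteq> {..<5}" "card T = 2"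
    using exists_subset_between[of ?S 2 "{..<5}"] by auto
  then obtain k m where km: "T = {k, m}" "k \<noteq> m"
    by (meson card_2_iff)
  have "(\<Sum>i<5. c i * f i) = (\<Sum>i\<in>T. c i * f i)" for c :: "nat \<Rightarrow> 'a"
    using T by (intro sum.mono_neutral_right) auto
  then have pq: "P k * f k + P m * f m = 0" "Q k * f k + Q m * f m = 0"
    using zero km by simp_all
  \<comment> \<open>Cramer's rule: each combination of the two checks eliminates one unknown and
    leaves the minor times the other.\<close>
  have "(P k * Q m - Q k * P m) * f k =
      Q m * (P k * f k + P m * f m) - P m * (Q k * f k + Q m * f m)"
    "(P k * Q m - Q k * P m) * f m =
      P k * (Q k * f k + Q m * f m) - Q k * (P k * f k + P m * f m)"
    by (simp_all add: algebra_simps)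
  then have "(P k * Q m - Q k * P m) * f k = 0" "(P k * Q m - Q k * P m) * f m = 0"
    unfolding pq by simp_all
  moreover have "P k * Q m - Q k * P m \<noteq> 0"
    using block_columns_independent[of k m] T(2) km by (simp add: P_def Q_def)
  ultimately have "f k = 0" "f m = 0"
    by simp_all
  then have "?S = {}"
    using T(1) km by auto
  then show False
    using nz by (simp add: block_weight_def f_def)
qed

text \<open>The global sums collapse to block \<open>j\<close> and give x = y = w^2 z. In the first
  local check x and y cancel, so a = z; in the second the two terms w^2 z cancel and w * w^2 = 1
  leaves b = z. Since the block is nonzero, so is z, and with it every entry.\<close>

lemma block_weight_single:
  assumes v: "v \<in> mat_kernel (parity_matrix w l)" and j: "j < l" and nz: "block_weight v j \<noteq> 0"
    and others: "\<And>j'. j' < l \<Longrightarrow> j' \<noteq> j \<Longrightarrow> block_weight v j' = 0"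
  shows "block_weight v j = 5"
proof -
  let ?a = "v $ (5 * j)" and ?b = "v $ (5 * j + 1)" and ?x = "v $ (5 * j + 2)"
    and ?y = "v $ (5 * j + 3)" and ?z = "v $ (5 * j + 4)"
  have zero: "v $ (5 * j' + k) = 0" if "j' < l" "j' \<noteq> j" "k < 5" for j' k
    using others[OF that(1,2)] that(3) by (auto simp: block_weight_def)
  have collapse: "(\<Sum>j'<l. v $ (5 * j' + k) + w\<^sup>2 * v $ (5 * j' + 4)) =
      v $ (5 * j + k) + w\<^sup>2 * ?z" if "k < 5" for k
    using j that by (subst sum.remove[of _ j]) (auto simp: zero intro!: sum.neutral)
  have eqs: "?a + ?x + ?y + ?z = 0" "?b + ?x + w * ?y + w\<^sup>2 * ?z = 0"
    "?x = w\<^sup>2 * ?z" "?y = w\<^sup>2 * ?z"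
  proof -
    have "v $ (5 * j + k) = w\<^sup>2 * ?z" if k: "k \<in> {2, 3}" for k
    proof -
      have "(\<Sum>j'<l. v $ (5 * j' + k) + w\<^sup>2 * v $ (5 * j' + 4)) = 0" "k < 5"
        using v k unfolding mem_mat_kernel_parity_iff by auto
      then show ?thesis
        by (simp only: collapse add_eq_0_iff_eq)
    qed
    then show "?x = w\<^sup>2 * ?z" "?y = w\<^sup>2 * ?z"
      by blast+
  qed (use v j in \<open>auto simp: mem_mat_kernel_parity_iff\<close>)
  have "?a = ?z"
    using eqs(1) unfolding eqs(3,4) by (simp only: add.assoc self_add_left add_eq_0_iff_eq)
  moreover have "?b = ?z"
  proof -
    have "?b + w * (w\<^sup>2 * ?z) = 0"
      using eqs(2) unfolding eqs(3,4)
      by (simp add: add.assoc self_add_left add.left_commute[of _ "w * _"] self_add)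
    then show ?thesis
      by (simp add: add_eq_0_iff_eq w_cube flip: mult.assoc)
  qed
  ultimately have ab: "?a = ?z" "?b = ?z"
    by simp_all
  have "?z \<noteq> 0"
    using nz unfolding block_weight_conv ab eqs(3,4) by (intro notI) simp
  then have "?z \<noteq> 0" "w\<^sup>2 * ?z \<noteq> 0"
    using w_nonzero(1) by simp_all
  then show ?thesis
    unfolding block_weight_conv ab eqs(3,4) by simp
qed

text \<open>This is the pattern forced on an isolated block, with z = 1. In block 0 it attains the
  minimum distance; in any block \<open>t\<close> it tests how a repair group meets that
  block.\<close>

lemma single_block_word_mem:
  assumes "t < l"
  shows "block_word l (\<lambda>j k. if j = t then [1, 1, w\<^sup>2, w\<^sup>2, 1] ! k else 0)
    \<in> mat_kernel (parity_matrix w l)"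
proof -
  define c where "c k = [1, 1, w\<^sup>2, w\<^sup>2, 1] ! k" for k
  have c: "c 0 = 1" "c 1 = 1" "c 2 = w\<^sup>2" "c 3 = w\<^sup>2" "c 4 = 1"
    by (simp_all add: c_def)
  have eqs: "c 0 + c 2 + c 3 + c 4 = 0"
    unfolding c by (simp only: add.assoc self_add_left self_add add_0_left)
  have eqs': "c 1 + c 2 + w * c 3 + w\<^sup>2 * c 4 = 0"
    unfolding c w_cube mult_1_right add.assoc[of "1 + w\<^sup>2"] by (rule self_add)
  have eqs'': "c 2 + w\<^sup>2 * c 4 = 0" "c 3 + w\<^sup>2 * c 4 = 0"
    unfolding c mult_1_right by (rule self_add)+
  \<comment> \<open>Each block has zero global contribution by itself, so the global sums vanish
    termwise.\<close>
  have block: "(if j = t then c 0 else 0) + (if j = t then c 2 else 0) +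
        (if j = t then c 3 else 0) + (if j = t then c 4 else 0) = 0 \<and>
      (if j = t then c 1 else 0) + (if j = t then c 2 else 0) + w * (if j = t then c 3 else 0) +
        w\<^sup>2 * (if j = t then c 4 else 0) = 0 \<and>
      (if j = t then c 2 else 0) + w\<^sup>2 * (if j = t then c 4 else 0) = 0 \<and>
      (if j = t then c 3 else 0) + w\<^sup>2 * (if j = t then c 4 else 0) = 0" for j :: nat
  proof (cases "j = t")
    case True
    then show ?thesis
      by (simp only: eqs eqs' eqs'' simp_thms if_True)
  next
    case False
    then show ?thesis
      by (simp only: if_False mult_zero_right add_0_right simp_thms)
  qed
  show ?thesis
    unfolding block_word_mem_iff c_def[symmetric] using block
    by (intro conjI allI impI sum.neutral ballI) blast+
qed

text \<open>No entry of the pattern is 0, so restricting the word to a repair group counts the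
  points of the group in block \<open>t\<close>.\<close>

lemma single_block_word_nonzero_iff:
  assumes "i < 5 * l"
  shows "block_word l (\<lambda>j k. if j = t then [1, 1, w\<^sup>2, w\<^sup>2, 1] ! k else 0) $ i \<noteq> 0 \<longleftrightarrow>
    i div 5 = t"
proof -
  have "[1, 1, w\<^sup>2, w\<^sup>2, 1] ! k \<noteq> 0" if "k < 5" for k
  proof -
    from that consider "k = 0" | "k = 1" | "k = 2" | "k = 3" | "k = 4"
      by linarith
    then show ?thesis
      using w_nonzero by cases auto
  qed
  then show ?thesis
    using assms by (simp add: block_word_def)
qed

text \<open>In characteristic 2 a repeated block has vanishing global syndrome.\<close>

lemma double_block_word_mem:
  assumes "l \<ge> 2"
    and "c ! 0 + c ! 2 + c ! 3 + c ! 4 = 0" "c ! 1 + c ! 2 + w * c ! 3 + w\<^sup>2 * c ! 4 = 0"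
  shows "block_word l (\<lambda>j k. if j \<le> 1 then c ! k else 0) \<in> mat_kernel (parity_matrix w l)"
proof -
  have sums: "(\<Sum>j<l. (if j \<le> 1 then s else 0) + w\<^sup>2 * (if j \<le> 1 then t else 0)) = 0" for s t :: 'a
  proof -
    have "(if j \<le> 1 then s else 0) + w\<^sup>2 * (if j \<le> 1 then t else 0) =
        (if j \<le> 1 then s + w\<^sup>2 * t else 0)" for j :: nat
      by simp
    moreover have "(\<Sum>j<l. if j \<le> 1 then r else 0) = (0 :: 'a)" for r
    proof -
      \<comment> \<open>Both blocks 0 and 1 exist because \<open>l \<ge> 2\<close>, so the summand
        occurs exactly twice and cancels.\<close>
      have "{..<l} \<inter> {j. j \<le> 1} = {0, 1}"
        using assms(1) by auto
      then have "(\<Sum>j<l. if j \<le> 1 then r else 0) = r + r"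
        by (simp add: sum.If_cases)
      then show ?thesis
        by (simp only: self_add)
    qed
    ultimately show ?thesis
      by (simp only:)
  qed
  have block: "(if j \<le> 1 then c ! 0 else 0) + (if j \<le> 1 then c ! 2 else 0) +
        (if j \<le> 1 then c ! 3 else 0) + (if j \<le> 1 then c ! 4 else 0) = 0 \<and>
      (if j \<le> 1 then c ! 1 else 0) + (if j \<le> 1 then c ! 2 else 0) +
        w * (if j \<le> 1 then c ! 3 else 0) + w\<^sup>2 * (if j \<le> 1 then c ! 4 else 0) = 0" for j :: nat
  proof (cases "j \<le> 1")
    case True
    then show ?thesis
      by (simp only: assms(2,3) simp_thms if_True)
  next
    case False
    then show ?thesis
      by (simp only: if_False mult_zero_right add_0_right simp_thms)
  qed
  show ?thesis
    unfolding block_word_mem_iff using block by (intro conjI allI impI sums) blast+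
qed

section \<open>The minimum distance\<close>

lemma has_min_dist_parity:
  assumes "l \<ge> 1"
  shows "has_min_dist (mat_kernel (parity_matrix w l)) 5"
  unfolding has_min_dist_def min_dist_at_least_def
proof (intro conjI ballI impI)
  fix v assume v: "v \<in> mat_kernel (parity_matrix w l)" and nz: "v \<noteq> 0\<^sub>v (dim_vec v)"
  have vc: "v \<in> carrier_vec (5 * l)"
    using v mem_mat_kernel_parity_iff by blast
  then obtain j where j: "j < l" "block_weight v j \<noteq> 0"
    using block_nonzero nz by force
  show "5 \<le> weight v"
  proof (cases "\<exists>j'<l. j' \<noteq> j \<and> block_weight v j' \<noteq> 0")
    case True
    then obtain j' where j': "j' < l" "j' \<noteq> j" "block_weight v j' \<noteq> 0"
      by blast
    have "block_weight v j + block_weight v j' \<le> weight v"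
      using block_weight_sum_le[OF vc, of "{j, j'}"] j j' by simp
    then show ?thesis
      using block_weight_ge_3[OF v j] block_weight_ge_3[OF v j'(1,3)] by linarith
  next
    case False
    then have "block_weight v j = 5"
      using block_weight_single[OF v j] by blast
    then show ?thesis
      using block_weight_sum_le[OF vc, of "{j}"] j by simp
  qed
next
  let ?u = "block_word l (\<lambda>j k. if j = 0 then [1, 1, w\<^sup>2, w\<^sup>2, 1] ! k else 0)"
  have "{i. i < 5 * l \<and> ?u $ i \<noteq> 0} = {i. i < 5 * l \<and> i div 5 = 0}"
    using single_block_word_nonzero_iff by blast
  also have "\<dots> = {..<5}"
    using assms by auto
  finally have "weight ?u = 5"
    by (simp add: weight_def)
  moreover from this have "?u \<noteq> 0\<^sub>v (dim_vec ?u)"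
    using weight_eq_0_iff[of ?u] by simp
  moreover have "?u \<in> mat_kernel (parity_matrix w l)"
    using assms by (intro single_block_word_mem) simp
  ultimately show
    "\<exists>v\<in>mat_kernel (parity_matrix w l). v \<noteq> 0\<^sub>v (dim_vec v) \<and> weight v = 5"
    by (intro bexI[of _ ?u] conjI)
qed

section \<open>Repair groups: locality and its minimality\<close>

lemma repair_group_block:
  assumes "j < l"
  shows "min_dist_at_least (puncture {5 * j..<5 * j + 5} (mat_kernel (parity_matrix w l))) 3"
  unfolding min_dist_at_least_puncture_iff
proof
  fix v assume v: "v \<in> mat_kernel (parity_matrix w l)"
  then have "v \<in> carrier_vec (5 * l)"
    using mem_mat_kernel_parity_iff by blast
  note eq = weight_in_block[OF this assms]
  show "card {i \<in> {5 * j..<5 * j + 5}. i < dim_vec v \<and> v $ i \<noteq> 0} \<noteq> 0 \<longrightarrow>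
      3 \<le> card {i \<in> {5 * j..<5 * j + 5}. i < dim_vec v \<and> v $ i \<noteq> 0}"
    unfolding eq using block_weight_ge_3[OF v assms] by blast
qed

text \<open>For \<open>p \<ge> 2\<close> column \<open>p\<close> has the form (1, s), so in
  characteristic 2 the entries 1, s, 1 at positions 0, 1, \<open>p\<close> satisfy both local
  checks. For \<open>p = 1\<close> the word belonging to column 2 is reused with
  \<open>q = 2\<close>.\<close>

lemma local_word_of_weight_3:
  assumes "p \<in> {1, 2, 3, 4 :: nat}"
  obtains c q where "c ! 0 \<noteq> 0" "\<forall>k<5. c ! k \<noteq> 0 \<longrightarrow> k \<in> {0, p, q}"
    "c ! 0 + c ! 2 + c ! 3 + c ! 4 = 0" "c ! 1 + c ! 2 + w * c ! 3 + w\<^sup>2 * c ! 4 = 0"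
proof -
  consider "p = 1" | "p = 2" | "p = 3" | "p = 4"
    using assms by auto
  then show thesis
  proof cases
    case 1
    show thesis
      by (rule that[of "[1, 1, 1, 0, 0]" 2]) (use 1 two in \<open>auto simp: less_Suc_eq numeral_eq_Suc\<close>)
  next
    case 2
    show thesis
      by (rule that[of "[1, 1, 1, 0, 0]" 1]) (use 2 two in \<open>auto simp: less_Suc_eq numeral_eq_Suc\<close>)
  next
    case 3
    show thesis
      by (rule that[of "[1, w, 0, 1, 0]" 1])
        (use 3 two self_add in \<open>auto simp: less_Suc_eq numeral_eq_Suc\<close>)
  next
    case 4
    show thesis
      by (rule that[of "[1, w\<^sup>2, 0, 0, 1]" 1])
        (use 4 two self_add in \<open>auto simp: less_Suc_eq numeral_eq_Suc\<close>)
  qed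
qed

text \<open>The bound 4 is \<open>r' + \<delta> - 1\<close> for \<open>r' = 2\<close> and
  \<open>\<delta> = 3\<close>, so coordinate 0 alone rules out every locality below 3.\<close>

lemma no_small_repair_group:
  assumes l: "l \<ge> 2" and R: "R \<subseteq> {..<5 * l}" "0 \<in> R" "card R \<le> 4"
  shows "\<not> min_dist_at_least (puncture R (mat_kernel (parity_matrix w l))) 3"
proof
  assume "min_dist_at_least (puncture R (mat_kernel (parity_matrix w l))) 3"
  then have dist: "card {i \<in> R. i < dim_vec v \<and> v $ i \<noteq> 0} = 0 \<or>
      3 \<le> card {i \<in> R. i < dim_vec v \<and> v $ i \<noteq> 0}"
    if "v \<in> mat_kernel (parity_matrix w l)" for v
    using that unfolding min_dist_at_least_puncture_iff by blast
  have fin: "finite R"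
    using R(1) finite_subset by blast
  define B where "B t = {i \<in> R. i div 5 = t}" for t
  have B: "B t = {} \<or> 3 \<le> card (B t)" if "t < l" for t
  proof -
    let ?u = "block_word l (\<lambda>j k. if j = t then [1, 1, w\<^sup>2, w\<^sup>2, 1] ! k else 0)"
    have "i < 5 * l" "?u $ i \<noteq> 0 \<longleftrightarrow> i div 5 = t" if "i \<in> R" for i
      using that R(1) by (auto intro!: single_block_word_nonzero_iff)
    then have "{i \<in> R. i < dim_vec ?u \<and> ?u $ i \<noteq> 0} = B t"
      unfolding B_def dim_block_word by blast
    then show ?thesis
      using dist[OF single_block_word_mem[OF that]] fin by (simp add: B_def)
  qed
  have "0 \<in> B 0"
    using R(2) by (simp add: B_def)
  then have "3 \<le> card (B 0)"
    using B[of 0] l by auto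
  \<comment> \<open>Meeting a second block would cost at least three more points, six in
    all.\<close>
  have "R \<subseteq> B 0"
  proof
    fix q assume q: "q \<in> R"
    show "q \<in> B 0"
    proof (rule ccontr)
      assume "q \<notin> B 0"
      then have t: "q div 5 \<noteq> 0"
        using q by (simp add: B_def)
      have "3 \<le> card (B (q div 5))"
        using B[of "q div 5"] q R(1) by (fastforce simp: B_def)
      moreover have "card (B 0) + card (B (q div 5)) = card (B 0 \<union> B (q div 5))"
        using fin t by (intro card_Un_disjoint[symmetric]) (auto simp: B_def)
      moreover have "card (B 0 \<union> B (q div 5)) \<le> card R"
        using fin by (intro card_mono) (auto simp: B_def)
      ultimately show False
        using R(3) \<open>3 \<le> card (B 0)\<close> by linarith
    qed
  qed
  then have R5: "R \<subseteq> {..<5}"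
    by (auto simp: B_def)
  moreover have "R \<noteq> {..<5}"
    using R(3) by auto
  ultimately obtain p where p: "p < 5" "p \<notin> R"
    by blast
  then have "p \<noteq> 0"
    using R(2) by metis
  then have "p \<in> {1, 2, 3, 4}"
    using p(1) by auto
  then obtain c q where c: "c ! 0 \<noteq> 0" "\<forall>k<5. c ! k \<noteq> 0 \<longrightarrow> k \<in> {0, p, q}"
    "c ! 0 + c ! 2 + c ! 3 + c ! 4 = 0" "c ! 1 + c ! 2 + w * c ! 3 + w\<^sup>2 * c ! 4 = 0"
    by (rule local_word_of_weight_3)
  \<comment> \<open>The copy in block 1 only balances the global checks: it lies outside
    \<open>R\<close>, which is contained in block 0.\<close>
  let ?u = "block_word l (\<lambda>j k. if j \<le> 1 then c ! k else 0)"
  let ?S = "{i \<in> R. i < dim_vec ?u \<and> ?u $ i \<noteq> 0}"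
  have u: "?u $ i = c ! i" if "i < 5" for i
    using that l by (simp add: block_word_def)
  have S0: "0 \<in> ?S"
    using R(2) c(1) l by (simp add: u del: One_nat_def)
  have Sq: "?S \<subseteq> {0, q}"
  proof
    fix i assume i: "i \<in> ?S"
    then have "i < 5"
      using R5 by blast
    then have "i \<in> {0, p, q}"
      using i c(2) u by auto
    then show "i \<in> {0, q}"
      using i p(2) by blast
  qed
  have "finite ?S"
    using Sq by (rule finite_subset) simp
  then have "0 < card ?S"
    using S0 card_gt_0_iff by blast
  moreover have "card ?S \<le> card {0, q}"
    using Sq by (intro card_mono) simp_all
  moreover have "card {0, q} \<le> 2"
    by (simp add: card_insert_le_m1)
  ultimately show False
    using dist[OF double_block_word_mem[OF l c(3,4)]] by linarith
qed

end

section \<open>Parameters and optimality of the code\<close>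

theorem mainTheorem13:
  fixes w :: "'a::field" and l :: nat
  assumes "card (UNIV :: 'a set) = 4" and "w\<^sup>2 = w + 1" and "l \<ge> 3"
  shows "optimal_lrc (5 * l) (3 * l - 2) 5 3 3 (mat_kernel (parity_matrix w l))"
proof -
  let ?C = "mat_kernel (parity_matrix w l)"
  have two: "(1 :: 'a) + 1 = 0"
    using assms(1) by (rule card_4_field_char_2)
  have code: "linear_code (5 * l) ?C" "code_dim (5 * l) ?C = 5 * l - (2 * l + 2)"
    by (rule mat_kernel_of_surj[OF parity_matrix_carrier], rule parity_matrix_surj,
        use assms(3) in simp, assumption)+
  have nkd: "nkd_code (5 * l) (3 * l - 2) 5 ?C"
    using code has_min_dist_parity[OF two assms(2)] assms(3) by (simp add: nkd_code_def)
  have lrc: "lrc (5 * l) 3 3 ?C"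
    unfolding lrc_def
  proof (intro conjI allI impI)
    fix i assume i: "i < 5 * l"
    \<comment> \<open>The repair group of a coordinate is its own block, of size 5 = 3 + 3 -
      1.\<close>
    define j where "j = i div 5"
    have "j < l" "i \<in> {5 * j..<5 * j + 5}"
      using i by (auto simp: j_def)
    then show "\<exists>R\<subseteq>{..<5 * l}. i \<in> R \<and> card R \<le> 3 + 3 - 1 \<and> min_dist_at_least (puncture R ?C) 3"
      by (intro exI[of _ "{5 * j..<5 * j + 5}"])
        (auto intro: repair_group_block[OF two assms(2)])
  qed (fact code(1))
  \<comment> \<open>The quotient l - 2/3 lies strictly between l - 1 and l, so the bound evaluates
    to 5l - (3l - 2) + 1 - 2(l - 1) = 5.\<close>
  have "\<lceil>real (3 * l - 2) / real 3\<rceil> = int l"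
    using assms(3) by (intro ceiling_unique) (auto simp: field_simps)
  then have d_opt: "d_optimal (5 * l) (3 * l - 2) 5 3 3"
    using assms(3) by (simp add: d_optimal_def)
  have r_opt: "r_optimal (5 * l) 3 3 ?C"
    unfolding r_optimal_def
  proof (intro allI impI notI)
    fix r' :: nat assume r': "1 \<le> r' \<and> r' < 3" and lrc': "lrc (5 * l) r' 3 ?C"
    have "0 < 5 * l"
      using assms(3) by simp
    then obtain R where R: "R \<subseteq> {..<5 * l}" "0 \<in> R" "card R \<le> r' + 3 - 1"
      "min_dist_at_least (puncture R ?C) 3"
      using lrc' unfolding lrc_def by blast
    have "\<not> min_dist_at_least (puncture R ?C) 3"
      using R(3) r' assms(3) by (intro no_small_repair_group[OF two assms(2) _ R(1,2)]) auto
    then show False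
      using R(4) by contradiction
  qed
  show ?thesis
    unfolding optimal_lrc_def using nkd lrc d_opt r_opt assms(3) by auto
qed

end
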